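(* Let $f:\mathbb{A}\to\mathbb{A}$ be a $C^1$ symplectic twist diffeomorphism that is $C^0$-integrable, let $u$ be the generating function of its invariant foliation, and let $\eta_c(\theta)=c+\frac{\partial u}{\partial\theta}(\theta,c)$. Then on every compact subset of $\mathbb{A}$ the foliation $(\theta,c)\mapsto\eta_c(\theta)$ is uniformly $\frac12$-Hölder in the variable $c$; that is, for every compact $K\subset\mathbb{A}$ there is a constant $C_K$ such that $|\eta_c(\theta)-\eta_{c'}(\theta)|\le C_K|c-c'|^{1/2}$ for all $(\theta,c),(\theta,c')\in K$.
   Context: $\mathbb{T}=\mathbb{R}/\mathbb{Z}$, $\mathbb{A}=\mathbb{T}\times\mathbb{R}$ with coordinates $(\theta,r)$ and symplectic form $\omega=-d(r\,d\theta)$. A symplectic twist diffeomorphism is a $C^1$ diffeomorphism $f:\mathbb{A}\to\mathbb{A}$ isotopic to the identity, with $f^*\omega=\omega$, and with the twist property: for any lift $F=(F_1,F_2):\mathbb{R}^2\to\mathbb{R}^2$ of $f$ and any $\tilde\theta\in\mathbb{R}$, the map $r\mapsto F_1(\tilde\theta,r)$ is an increasing $C^1$ diffeomorphism from $\mathbb{R}$ onto $\mathbb{R}$. A continuous ($C^0$) foliation of $\mathbb{A}$ into graphs is a partition of $\mathbb{A}$ into graphs of continuous functions $\eta_c:\mathbb{T}\to\mathbb{R}$, $c\in\mathbb{R}$, normalized by $\int_{\mathbb{T}}\eta_c=c$, such that $(\theta,c)\mapsto(\theta,\eta_c(\theta))$ is a homeomorphism of $\mathbb{A}$. A foliation is invariant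 under $f$ if every leaf is mapped onto itself by $f$. $f$ is $C^0$-integrable if it has an invariant $C^0$-foliation into graphs. The generating function of such a foliation is the unique continuous $u:\mathbb{A}\to\mathbb{R}$ that is $C^1$ in the $\mathbb{T}$ variable with $u(0,c)=0$ for all $c$ and such that, for all $c$, the graph of $c+\frac{\partial u}{\partial\theta}(\cdot,c)$ is a leaf. *)

theory Defs
  imports "HOL-Analysis.Analysis"
begin

quotient_type circle = real / "\<lambda>x y. x - y \<in> \<int>"
proof (rule equivpI)
  show "reflp (\<lambda>x y::real. x - y \<in> \<int>)"
    by (simp add: reflp_def)
  show "symp (\<lambda>x y::real. x - y \<in> \<int>)"
    by (rule sympI) (drule Ints_minus, simp)
  show "transp (\<lambda>x y::real. x - y \<in> \<int>)"
    by (rule transpI) (drule (1) Ints_add, simp)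
qed

text \<open>The topology of \<open>circle\<close> is the quotient topology.\<close>

instantiation circle :: topological_space
begin

definition open_circle :: "circle set \<Rightarrow> bool" where
  "open_circle U \<longleftrightarrow> open (abs_circle -` U)"

instance
proof
  show "open (UNIV :: circle set)"
    by (simp add: open_circle_def)
  show "open (U \<inter> V)" if "open U" "open V" for U V :: "circle set"
    using that by (simp add: open_circle_def open_Int)
  show "open (\<Union>\<U>)" if "\<forall>U\<in>\<U>. open U" for \<U> :: "circle set set"
    using that by (simp add: open_circle_def vimage_Union open_UN)
qed

end

type_synonym annulus = "circle \<times> real"

definition annulus_proj :: "real \<times> real \<Rightarrow> annulus" where
  "annulus_proj z = (abs_circle (fst z), snd z)"

definition is_lift :: "(annulus \<Rightarrow> annulus) \<Rightarrow> (real \<times> real \<Rightarrow> real \<times> real) \<Rightarrow> bool" where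
  "is_lift f F \<longleftrightarrow>
     continuous_on UNIV F \<and> (\<forall>z. annulus_proj (F z) = f (annulus_proj z))"

definition C1_plane :: "(real \<times> real \<Rightarrow> real \<times> real) \<Rightarrow> bool" where
  "C1_plane F \<longleftrightarrow>
     (\<exists>F' :: real \<times> real \<Rightarrow> (real \<times> real) \<Rightarrow>\<^sub>L (real \<times> real).
        (\<forall>z. (F has_derivative blinfun_apply (F' z)) (at z)) \<and> continuous_on UNIV F')"

text \<open>The covering \<^const>\<open>annulus_proj\<close> is a local diffeomorphism and every continuous self-map of
  the annulus has a lift, so a self-map is \<open>C\<^sup>1\<close> exactly if it has a \<open>C\<^sup>1\<close> lift.\<close>

definition C1_annulus :: "(annulus \<Rightarrow> annulus) \<Rightarrow> bool" where
  "C1_annulus f \<longleftrightarrow> (\<exists>F. is_lift f F \<and> C1_plane F)"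

definition C1_diffeo_annulus :: "(annulus \<Rightarrow> annulus) \<Rightarrow> bool" where
  "C1_diffeo_annulus f \<longleftrightarrow> bij f \<and> C1_annulus f \<and> C1_annulus (inv f)"

definition isotopic_to_id :: "(annulus \<Rightarrow> annulus) \<Rightarrow> bool" where
  "isotopic_to_id f \<longleftrightarrow>
     homotopic_with (homeomorphic_map euclidean euclidean) euclidean euclidean id f"

text \<open>\<open>-d(r d\<theta>) = d\<theta> \<and> dr\<close> has constant coefficients in the global frame
  \<open>(\<partial>/\<partial>\<theta>, \<partial>/\<partial>r)\<close>, so it is given by one bilinear form on all tangent spaces.\<close>

definition \<omega> :: "real \<times> real \<Rightarrow> real \<times> real \<Rightarrow> real" where
  "\<omega> v w = fst v * snd w - snd v * fst w"

text \<open>In that frame the tangent map of \<open>f\<close> is the derivative of any lift.\<close>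

definition preserves_\<omega> :: "(annulus \<Rightarrow> annulus) \<Rightarrow> bool" where
  "preserves_\<omega> f \<longleftrightarrow>
     (\<forall>F z v w. is_lift f F \<longrightarrow>
        \<omega> (frechet_derivative F (at z) v) (frechet_derivative F (at z) w) = \<omega> v w)"

definition increasing_C1_diffeo :: "(real \<Rightarrow> real) \<Rightarrow> bool" where
  "increasing_C1_diffeo g \<longleftrightarrow>
     strict_mono g \<and> bij g \<and> g C1_differentiable_on UNIV \<and> inv g C1_differentiable_on UNIV"

definition twist_property :: "(annulus \<Rightarrow> annulus) \<Rightarrow> bool" where
  "twist_property f \<longleftrightarrow>
     (\<forall>F. is_lift f F \<longrightarrow> (\<forall>t. increasing_C1_diffeo (\<lambda>r. fst (F (t, r)))))"

definition symplectic_twist_diffeo :: "(annulus \<Rightarrow> annulus) \<Rightarrow> bool" where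
  "symplectic_twist_diffeo f \<longleftrightarrow>
     C1_diffeo_annulus f \<and> isotopic_to_id f \<and> preserves_\<omega> f \<and> twist_property f"

definition circle_integral :: "(circle \<Rightarrow> real) \<Rightarrow> real" where
  "circle_integral g = integral {0..1} (\<lambda>x. g (abs_circle x))"

definition C1_circle :: "(circle \<Rightarrow> real) \<Rightarrow> bool" where
  "C1_circle g \<longleftrightarrow> (\<lambda>x. g (abs_circle x)) C1_differentiable_on UNIV"

lift_definition circle_deriv :: "(circle \<Rightarrow> real) \<Rightarrow> circle \<Rightarrow> real"
  is "\<lambda>g x. deriv (\<lambda>t. g (abs_circle t)) x"
proof -
  fix g :: "circle \<Rightarrow> real" and x y :: real
  assume xy: "x - y \<in> \<int>"
  have "abs_circle (t + (x - y)) = abs_circle t" for t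
    using xy by (simp add: circle.abs_eq_iff)
  then have "DERIV (\<lambda>t. g (abs_circle t)) (y + (x - y)) :> D \<longleftrightarrow>
             DERIV (\<lambda>t. g (abs_circle t)) y :> D" for D
    by (subst DERIV_shift) simp
  then show "deriv (\<lambda>t. g (abs_circle t)) x = deriv (\<lambda>t. g (abs_circle t)) y"
    by (simp add: deriv_def)
qed

definition circle_graph :: "(circle \<Rightarrow> real) \<Rightarrow> annulus set" where
  "circle_graph g = range (\<lambda>\<theta>. (\<theta>, g \<theta>))"

text \<open>A foliation is represented by its set of leaves.\<close>

definition C0_foliation :: "annulus set set \<Rightarrow> bool" where
  "C0_foliation \<F> \<longleftrightarrow>
     partition_on UNIV \<F> \<and>
     (\<exists>\<eta> :: real \<Rightarrow> circle \<Rightarrow> real.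
        \<F> = range (\<lambda>c. circle_graph (\<eta> c)) \<and>
        (\<forall>c. continuous_on UNIV (\<eta> c) \<and> circle_integral (\<eta> c) = c) \<and>
        homeomorphic_map euclidean euclidean (\<lambda>(\<theta>, c). (\<theta>, \<eta> c \<theta>)))"

definition invariant_foliation :: "(annulus \<Rightarrow> annulus) \<Rightarrow> annulus set set \<Rightarrow> bool" where
  "invariant_foliation f \<F> \<longleftrightarrow> C0_foliation \<F> \<and> (\<forall>L\<in>\<F>. f ` L = L)"

definition leaf_function :: "(annulus \<Rightarrow> real) \<Rightarrow> real \<Rightarrow> circle \<Rightarrow> real" where
  "leaf_function u c \<theta> = c + circle_deriv (\<lambda>\<tau>. u (\<tau>, c)) \<theta>"

definition generating_function :: "annulus set set \<Rightarrow> (annulus \<Rightarrow> real) \<Rightarrow> bool" where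
  "generating_function \<F> u \<longleftrightarrow>
     continuous_on UNIV u \<and>
     (\<forall>c. C1_circle (\<lambda>\<theta>. u (\<theta>, c))) \<and>
     (\<forall>c. u (abs_circle 0, c) = 0) \<and>
     (\<forall>c. circle_graph (leaf_function u c) \<in> \<F>)"

end

theory Submission imports Defs begin

text \<open>The leaves \<open>\<eta>\<^sub>c\<close> are disjoint graphs with integral \<open>c\<close>, so for \<open>c < c'\<close> the leaf
  \<open>\<eta>\<^sub>c\<^sub>'\<close> lies above \<open>\<eta>\<^sub>c\<close> and the area between them is \<open>c' - c\<close>. If both leaves are \<open>L\<close>-Lipschitz, then a gap
  of height \<open>h\<close> at one angle closes at speed at most \<open>2 L\<close>, so the enclosed area contains a triangle
  of area of order \<open>h\<^sup>2 / L\<close>. Hence \<open>h\<close> is at most of order \<open>(L (c' - c))\<^sup>1\<^sup>/\<^sup>2\<close>, and the exponent one half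
  is that of the area of a triangle with sides of bounded slope
  (\<open>Lipschitz_square_le_integral\<close>).

  A Lipschitz constant that serves for all leaves in a compact region comes from Birkhoff's argument
  (\<open>invariant_graphs_uniformly_Lipschitz\<close>). The dynamics on an invariant graph is a monotone map of the
  line. A lift of the twist map moves points further to the right the higher they are, at a rate bounded below on
  compact sets, so steep secants of the graph in one direction would break monotonicity
  (\<open>twist_cone\<close>). The inverse map preserves the same graph, is monotone in the same
  sense, and twists to the left because the map is symplectic (\<open>symplectic_inverse_twist\<close>); this
  excludes steep secants in the other direction.\<close>

section \<open>Lifts\<close>

lemma annulus_proj_eq_iff:
  "annulus_proj z = annulus_proj w \<longleftrightarrow> fst z - fst w \<in> \<int> \<and> snd z = snd w"
  by (simp add: annulus_proj_def circle.abs_eq_iff)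

lemma continuous_abs_circle: "continuous_on UNIV abs_circle"
  by (auto simp: continuous_on_open_vimage open_circle_def)

text \<open>The composite lifts the identity, so it differs from the identity by an integer translation,
  which cannot jump.\<close>

lemma lift_comp_right_inverse:
  assumes F: "is_lift f F" and G: "is_lift g G" and fg: "\<And>p. f (g p) = p"
  obtains m where "\<And>z. F (G z) = z + (m, 0)"
proof -
  have proj: "annulus_proj (F (G z)) = annulus_proj z" for z
    using F G fg by (simp add: is_lift_def del: split_paired_All)
  define d where "d z = fst (F (G z)) - fst z" for z
  have "continuous_on UNIV (\<lambda>z. F (G z))"
    using F G by (auto simp: is_lift_def intro: continuous_on_compose2)
  then have cont: "continuous_on UNIV d"
    unfolding d_def by (intro continuous_intros)
  have int: "d z \<in> \<int>" for z
    using proj[of z] by (simp add: annulus_proj_eq_iff d_def)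
  have "d constant_on UNIV"
  proof (rule continuous_discrete_range_constant[OF _ cont])
    fix z
    have "1 \<le> norm (d w - d z)" if "d w \<noteq> d z" for w
      using Ints_nonzero_abs_ge1[of "d w - d z"] int that by (simp add: Ints_diff)
    then show "\<exists>e>0. \<forall>w. w \<in> UNIV \<and> d w \<noteq> d z \<longrightarrow> e \<le> norm (d w - d z)"
      by (intro exI[of _ 1]) auto
  qed (simp add: connected_UNIV)
  then obtain m where m: "\<And>z. d z = m"
    by (auto simp: constant_on_def)
  have "F (G z) = z + (m, 0)" for z
    using proj[of z] m[of z] unfolding annulus_proj_eq_iff d_def by (intro prod_eqI) auto
  then show ?thesis by (rule that)
qed

lemma lift_on_invariant_graph:
  assumes F: "is_lift f F" and inv: "f ` circle_graph \<eta> \<subseteq> circle_graph \<eta>"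
  shows "snd (F (x, \<eta> (abs_circle x))) = \<eta> (abs_circle (fst (F (x, \<eta> (abs_circle x)))))"
proof -
  have "annulus_proj (F (x, \<eta> (abs_circle x))) = f (abs_circle x, \<eta> (abs_circle x))"
    using F by (simp add: is_lift_def annulus_proj_def)
  also have "\<dots> \<in> circle_graph \<eta>"
    using inv by (auto simp: circle_graph_def)
  finally show ?thesis
    by (auto simp: circle_graph_def annulus_proj_def)
qed

section \<open>Invariant graphs are uniformly Lipschitz\<close>

text \<open>By the mean value theorem, the difference of \<open>H\<close> between two points is
  \<open>\<partial>\<^sub>\<theta>H \<Delta>x + \<partial>\<^sub>rH \<Delta>y\<close> at an intermediate point, so a steep upward displacement increases \<open>H\<close>.
  Compactness of the box gives the critical slope.\<close>

lemma twist_cone: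
  fixes H :: "real \<times> real \<Rightarrow> real"
  assumes deriv: "\<And>z. (H has_derivative H' z) (at z)"
    and cont: "\<And>v. continuous_on UNIV (\<lambda>z. H' z v)"
    and twist: "\<And>z. 0 < H' z (0, 1)"
  obtains L where "\<And>x x' y y'. \<lbrakk>x \<in> {0..1}; x' \<in> {0..1}; \<bar>y\<bar> \<le> R; \<bar>y'\<bar> \<le> R; y \<le> y';
      H (x', y') \<le> H (x, y)\<rbrakk> \<Longrightarrow> y' - y \<le> L * \<bar>x' - x\<bar>"
proof -
  define Q where "Q = {0..1::real} \<times> {-R..R}"
  have Q: "compact Q" "convex Q"
    by (auto simp: Q_def intro: compact_Times convex_Times)
  define s where "s z = \<bar>H' z (1, 0)\<bar> / H' z (0, 1)" for z
  have "continuous_on Q s"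
    unfolding s_def using twist
    by (intro continuous_intros continuous_on_subset[OF cont]) (auto simp: less_imp_neq[symmetric])
  then have "bounded (s ` Q)"
    using Q by (simp add: compact_continuous_image compact_imp_bounded)
  then obtain L where L: "\<And>z. z \<in> Q \<Longrightarrow> s z \<le> L"
    unfolding bounded_iff by (auto intro: order_trans[OF abs_ge_self])
  show ?thesis
  proof (rule that)
    fix x x' y y'
    assume box: "x \<in> {0..1}" "x' \<in> {0..1}" "\<bar>y\<bar> \<le> R" "\<bar>y'\<bar> \<le> R"
      and "y \<le> y'" and H: "H (x', y') \<le> H (x, y)"
    let ?z = "(x, y)" and ?w = "(x', y')"
    have inQ: "?z \<in> Q" "?w \<in> Q" using box by (auto simp: Q_def)
    let ?\<gamma> = "\<lambda>t. ?z + t *\<^sub>R (?w - ?z)"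
    have "((\<lambda>t. H (?\<gamma> t)) has_derivative (\<lambda>h. H' (?\<gamma> t) (h *\<^sub>R (?w - ?z)))) (at t)" for t
      by (rule has_derivative_compose[OF _ deriv]) (auto intro!: derivative_eq_intros)
    then have "((\<lambda>t. H (?\<gamma> t)) has_derivative (\<lambda>h. H' (?\<gamma> t) (h *\<^sub>R (?w - ?z))))
        (at t within {0..1})" for t
      by (rule has_derivative_at_withinI)
    then obtain t where t: "t \<in> {0..1}" and mvt: "H (?\<gamma> 1) - H (?\<gamma> 0) = H' (?\<gamma> t) ((1 - 0) *\<^sub>R (?w - ?z))"
      using mvt_very_simple[of 0 1 "\<lambda>t. H (?\<gamma> t)" "\<lambda>t h. H' (?\<gamma> t) (h *\<^sub>R (?w - ?z))"] by auto
    define p where "p = ?\<gamma> t"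
    have "p = (1 - t) *\<^sub>R ?z + t *\<^sub>R ?w"
      by (simp add: p_def algebra_simps)
    moreover have "\<dots> \<in> Q"
      using t by (intro convexD[OF Q(2) inQ]) auto
    ultimately have p: "p \<in> Q" by simp
    have lin: "linear (H' p)"
      using deriv has_derivative_linear by blast
    have "?w - ?z = (x' - x) *\<^sub>R (1, 0) + (y' - y) *\<^sub>R (0, 1)"
      by simp
    then have "H' p (?w - ?z) = (x' - x) * H' p (1, 0) + (y' - y) * H' p (0, 1)"
      by (simp only: linear_add[OF lin] linear_scale[OF lin] real_scaleR_def)
    with mvt H have "(y' - y) * H' p (0, 1) \<le> - ((x' - x) * H' p (1, 0))"
      by (simp add: p_def)
    also have "\<dots> \<le> \<bar>x' - x\<bar> * \<bar>H' p (1, 0)\<bar>"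
      by (metis abs_ge_minus_self abs_mult)
    finally have "y' - y \<le> s p * \<bar>x' - x\<bar>"
      using twist[of p] by (simp add: s_def field_simps)
    also have "\<dots> \<le> L * \<bar>x' - x\<bar>"
      using L[OF p] by (intro mult_right_mono) auto
    finally show "y' - y \<le> L * \<bar>x' - x\<bar>" .
  qed
qed

text \<open>The inverse of the \<open>C\<^sup>1\<close> diffeomorphism is differentiable, so the derivative, which is
  nonnegative by monotonicity, cannot vanish.\<close>

lemma increasing_C1_diffeo_deriv_pos:
  assumes g: "increasing_C1_diffeo g" and D: "(g has_real_derivative D) (at x)"
  shows "0 < D"
proof -
  have "D \<ge> 0"
    using g D by (intro mono_on_imp_deriv_nonneg[of UNIV g])
      (auto simp: increasing_C1_diffeo_def strict_mono_mono)
  obtain E where E: "(inv g has_real_derivative E) (at (g x))"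
    using g by (auto simp: increasing_C1_diffeo_def C1_differentiable_on_def
        has_real_derivative_iff_has_vector_derivative)
  have "((\<lambda>t. inv g (g t)) has_real_derivative E * D) (at x)"
    by (rule DERIV_chain2[OF E D])
  moreover have "(\<lambda>t. inv g (g t)) = (\<lambda>t. t)"
    using g by (simp add: increasing_C1_diffeo_def bij_is_inj)
  ultimately have "E * D = 1"
    by (metis DERIV_ident DERIV_unique)
  with \<open>D \<ge> 0\<close> show ?thesis
    by (cases "D = 0") auto
qed

text \<open>The map induced on a graph and its inverse will be compared through two lifts that are chosen
  independently, so they are inverse to each other only up to integer translations. A translation is increasing,
  hence the two maps have the same type of monotonicity.\<close>

lemma inverse_up_to_translation_monotone:
  fixes \<phi> \<psi> :: "real \<Rightarrow> real"
  assumes cont: "continuous_on UNIV \<phi>" "continuous_on UNIV \<psi>"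
    and \<phi>\<psi>: "\<And>x. \<phi> (\<psi> x) = x + m" and \<psi>\<phi>: "\<And>x. \<psi> (\<phi> x) = x + n"
  shows "strict_mono \<phi> \<and> strict_mono \<psi> \<or> strict_antimono_on UNIV \<phi> \<and> strict_antimono_on UNIV \<psi>"
proof -
  have "inj \<phi>" "inj \<psi>"
    using \<phi>\<psi> \<psi>\<phi> by (metis injI add_right_cancel)+
  then have "strict_mono \<phi> \<or> strict_antimono_on UNIV \<phi>" "strict_mono \<psi> \<or> strict_antimono_on UNIV \<psi>"
    using injective_eq_monotone_map[of UNIV] cont by auto
  moreover have "\<not> (strict_mono \<phi> \<and> strict_antimono_on UNIV \<psi>)"
  proof
    assume "strict_mono \<phi> \<and> strict_antimono_on UNIV \<psi>"
    then have "\<phi> (\<psi> 1) < \<phi> (\<psi> 0)"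
      by (auto simp: strict_mono_def monotone_on_def)
    then show False by (simp add: \<phi>\<psi>)
  qed
  moreover have "\<not> (strict_antimono_on UNIV \<phi> \<and> strict_mono \<psi>)"
  proof
    assume "strict_antimono_on UNIV \<phi> \<and> strict_mono \<psi>"
    then have "\<phi> (\<psi> 1) < \<phi> (\<psi> 0)"
      by (auto simp: strict_mono_def monotone_on_def)
    then show False by (simp add: \<phi>\<psi>)
  qed
  ultimately show ?thesis by blast
qed

lemma C1_planeE:
  assumes "C1_plane F"
  obtains F' where "\<And>z. (F has_derivative F' z) (at z)" "\<And>v. continuous_on UNIV (\<lambda>z. F' z v)"
proof -
  from assms obtain F' where "\<And>z. (F has_derivative blinfun_apply (F' z)) (at z)" "continuous_on UNIV F'"
    by (auto simp: C1_plane_def)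
  then show ?thesis
    by (intro that[of "\<lambda>z. blinfun_apply (F' z)"]) (auto intro!: continuous_intros)
qed

text \<open>An inverse lift twists in the opposite direction: a matrix of determinant one and its inverse
  have opposite upper right entries.\<close>

lemma symplectic_inverse_twist:
  fixes F' G' :: "real \<times> real \<Rightarrow> real \<times> real \<Rightarrow> real \<times> real"
  assumes F: "is_lift f F" "\<And>z. (F has_derivative F' z) (at z)"
    and G: "\<And>z. (G has_derivative G' z) (at z)"
    and FG: "\<And>z. F (G z) = z + (m, 0)"
    and sympl: "preserves_\<omega> f"
  shows "fst (G' z (0, 1)) = - fst (F' (G z) (0, 1))"
proof -
  have "((\<lambda>z. F (G z)) has_derivative (\<lambda>v. F' (G z) (G' z v))) (at z)"
    by (rule has_derivative_compose[OF G F(2)])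
  moreover have "((\<lambda>z. F (G z)) has_derivative (\<lambda>v. v)) (at z)"
    unfolding FG by (auto intro!: derivative_eq_intros)
  ultimately have inverse: "F' (G z) (G' z v) = v" for v
    by (metis has_derivative_unique)
  have "frechet_derivative F (at (G z)) = F' (G z)"
    using F(2) by (metis frechet_derivative_at)
  then have "\<omega> (F' (G z) v) (F' (G z) w) = \<omega> v w" for v w
    using sympl F(1) by (metis preserves_\<omega>_def)
  from this[of "G' z (0, 1)" "(0, 1)"] show ?thesis
    by (simp add: inverse \<omega>_def)
qed

lemma twist_lift_deriv_pos:
  assumes twist: "twist_property f" and F: "is_lift f F" and deriv: "\<And>z. (F has_derivative F' z) (at z)"
  shows "0 < fst (F' z (0, 1))"
proof -
  obtain x r where z: "z = (x, r)" by fastforce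
  have "((\<lambda>r. F (x, r)) has_derivative (\<lambda>h. F' z (0, h))) (at r)"
    unfolding z by (rule has_derivative_compose[OF _ deriv]) (auto intro!: derivative_eq_intros)
  then have "((\<lambda>r. fst (F (x, r))) has_derivative (\<lambda>h. fst (F' z (0, h)))) (at r)"
    by (rule has_derivative_fst)
  moreover have "(\<lambda>h. fst (F' z (0, h))) = (*) (fst (F' z (0, 1)))"
  proof
    fix h
    show "fst (F' z (0, h)) = fst (F' z (0, 1)) * h"
      using linear_scale[OF has_derivative_linear[OF deriv], of z h "(0, 1)"] by simp
  qed
  ultimately have "((\<lambda>r. fst (F (x, r))) has_real_derivative fst (F' z (0, 1))) (at r)"
    by (simp add: has_field_derivative_def)
  moreover have "increasing_C1_diffeo (\<lambda>r. fst (F (x, r)))"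
    using twist F by (simp add: twist_property_def)
  ultimately show ?thesis
    using increasing_C1_diffeo_deriv_pos by blast
qed

text \<open>On an invariant graph the dynamics is monotone. If it is increasing, then by the twist condition the
  graph cannot fall steeply, or the lift would reverse the order of two of its points; since the
  inverse twists the other way, it cannot rise steeply, either. If the dynamics is
  decreasing, the two arguments trade places. The bounds depend only on a box that contains the graph
  over one fundamental domain.\<close>

lemma invariant_graphs_uniformly_Lipschitz:
  assumes f: "symplectic_twist_diffeo f"
  obtains L where "\<And>\<eta> x y. \<lbrakk>continuous_on UNIV \<eta>; f ` circle_graph \<eta> = circle_graph \<eta>;
      \<And>x. x \<in> {0..1} \<Longrightarrow> \<bar>\<eta> (abs_circle x)\<bar> \<le> R; x \<in> {0..1}; y \<in> {0..1}\<rbrakk>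
      \<Longrightarrow> \<bar>\<eta> (abs_circle x) - \<eta> (abs_circle y)\<bar> \<le> L * \<bar>x - y\<bar>"
proof -
  have bij: "bij f" and sympl: "preserves_\<omega> f" and twist: "twist_property f"
    using f by (auto simp: symplectic_twist_diffeo_def C1_diffeo_annulus_def)
  obtain F G where F: "is_lift f F" "C1_plane F" and G: "is_lift (inv f) G" "C1_plane G"
    using f by (auto simp: symplectic_twist_diffeo_def C1_diffeo_annulus_def C1_annulus_def)
  obtain F' where F': "\<And>z. (F has_derivative F' z) (at z)" "\<And>v. continuous_on UNIV (\<lambda>z. F' z v)"
    using F(2) by (rule C1_planeE) blast
  obtain G' where G': "\<And>z. (G has_derivative G' z) (at z)" "\<And>v. continuous_on UNIV (\<lambda>z. G' z v)"
    using G(2) by (rule C1_planeE) blast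
  obtain m where FG: "\<And>z. F (G z) = z + (m, 0)"
    using lift_comp_right_inverse[OF F(1) G(1)] bij by (metis bij_inv_eq_iff)
  obtain n where GF: "\<And>z. G (F z) = z + (n, 0)"
    using lift_comp_right_inverse[OF G(1) F(1)] bij by (metis bij_inv_eq_iff)
  obtain L1 where L1: "\<And>x x' y y'. \<lbrakk>x \<in> {0..1}; x' \<in> {0..1}; \<bar>y\<bar> \<le> R; \<bar>y'\<bar> \<le> R; y \<le> y';
      fst (F (x', y')) \<le> fst (F (x, y))\<rbrakk> \<Longrightarrow> y' - y \<le> L1 * \<bar>x' - x\<bar>"
  proof (rule twist_cone[of "\<lambda>z. fst (F z)" "\<lambda>z v. fst (F' z v)" R])
    show "((\<lambda>z. fst (F z)) has_derivative (\<lambda>v. fst (F' z v))) (at z)" for z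
      by (rule has_derivative_fst[OF F'(1)])
    show "continuous_on UNIV (\<lambda>z. fst (F' z v))" for v
      by (intro continuous_intros F'(2))
    show "0 < fst (F' z (0, 1))" for z
      by (rule twist_lift_deriv_pos[OF twist F(1) F'(1)])
  qed blast
  obtain L2 where L2: "\<And>x x' y y'. \<lbrakk>x \<in> {0..1}; x' \<in> {0..1}; \<bar>y\<bar> \<le> R; \<bar>y'\<bar> \<le> R; y \<le> y';
      - fst (G (x', y')) \<le> - fst (G (x, y))\<rbrakk> \<Longrightarrow> y' - y \<le> L2 * \<bar>x' - x\<bar>"
  proof (rule twist_cone[of "\<lambda>z. - fst (G z)" "\<lambda>z v. - fst (G' z v)" R])
    show "((\<lambda>z. - fst (G z)) has_derivative (\<lambda>v. - fst (G' z v))) (at z)" for z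
      by (intro has_derivative_minus has_derivative_fst G'(1))
    show "continuous_on UNIV (\<lambda>z. - fst (G' z v))" for v
      by (intro continuous_intros G'(2))
    show "0 < - fst (G' z (0, 1))" for z
      using twist_lift_deriv_pos[OF twist F(1) F'(1)]
        symplectic_inverse_twist[OF F(1) F'(1) G'(1) FG sympl] by simp
  qed blast
  define L where "L = max 0 (max L1 L2)"
  show ?thesis
  proof (rule that)
    fix \<eta> and x y :: real
    assume cont: "continuous_on UNIV \<eta>" and inv: "f ` circle_graph \<eta> = circle_graph \<eta>"
      and R: "\<And>x. x \<in> {0..1} \<Longrightarrow> \<bar>\<eta> (abs_circle x)\<bar> \<le> R"
      and xy: "x \<in> {0..1}" "y \<in> {0..1}"
    define e where "e x = \<eta> (abs_circle x)" for x
    define \<phi> where "\<phi> x = fst (F (x, e x))" for x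
    define \<psi> where "\<psi> x = fst (G (x, e x))" for x
    have inv': "inv f ` circle_graph \<eta> = circle_graph \<eta>"
      using inv bij by (metis bij_is_inj image_inv_f_f)
    have \<phi>: "F (x, e x) = (\<phi> x, e (\<phi> x))" for x
      using lift_on_invariant_graph[OF F(1), of \<eta> x] inv by (simp add: \<phi>_def e_def prod_eq_iff)
    have \<psi>: "G (x, e x) = (\<psi> x, e (\<psi> x))" for x
      using lift_on_invariant_graph[OF G(1), of \<eta> x] inv' by (simp add: \<psi>_def e_def prod_eq_iff)
    have "continuous_on UNIV e"
      unfolding e_def by (rule continuous_on_compose2[OF cont continuous_abs_circle]) auto
    then have pair: "continuous_on UNIV (\<lambda>x. (x, e x))"
      by (intro continuous_intros)
    have "continuous_on UNIV \<phi>" "continuous_on UNIV \<psi>"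
      unfolding \<phi>_def \<psi>_def using F(1) G(1)
      by (auto simp: is_lift_def intro!: continuous_on_fst continuous_on_compose2[OF _ pair])
    moreover have "\<phi> (\<psi> t) = t + m" "\<psi> (\<phi> t) = t + n" for t
      using FG[of "(t, e t)"] GF[of "(t, e t)"] by (simp_all add: \<phi> \<psi>)
    ultimately have mono: "strict_mono \<phi> \<and> strict_mono \<psi> \<or> strict_antimono_on UNIV \<phi> \<and> strict_antimono_on UNIV \<psi>"
      by (rule inverse_up_to_translation_monotone)
    have steep: "e t - e s \<le> L * \<bar>t - s\<bar>" if st: "s \<in> {0..1}" "t \<in> {0..1}" for s t
    proof (cases "e s \<le> e t")
      case le: True
      \<comment> \<open>Whatever the order of \<open>s\<close> and \<open>t\<close>, one of the two maps brings the images into the order that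
        contradicts a steep slope.\<close>
      have "\<phi> t \<le> \<phi> s \<or> \<psi> s \<le> \<psi> t"
        using mono by (cases s t rule: linorder_cases) (auto simp: strict_mono_def monotone_on_def intro: less_imp_le)
      then have "e t - e s \<le> L1 * \<bar>t - s\<bar> \<or> e t - e s \<le> L2 * \<bar>t - s\<bar>"
        using L1[of s t "e s" "e t"] L2[of s t "e s" "e t"] R st le by (auto simp: \<phi>_def \<psi>_def e_def)
      moreover have "L1 * \<bar>t - s\<bar> \<le> L * \<bar>t - s\<bar>" "L2 * \<bar>t - s\<bar> \<le> L * \<bar>t - s\<bar>"
        by (auto simp: L_def intro!: mult_right_mono)
      ultimately show ?thesis by linarith
    next
      case False
      moreover have "0 \<le> L * \<bar>t - s\<bar>"
        by (simp add: L_def)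
      ultimately show ?thesis by linarith
    qed
    show "\<bar>\<eta> (abs_circle x) - \<eta> (abs_circle y)\<bar> \<le> L * \<bar>x - y\<bar>"
      using steep[of x y] steep[of y x] xy by (simp add: e_def abs_minus_commute abs_le_iff)
  qed
qed

section \<open>Leaves and the enclosed area\<close>

text \<open>A derivative on the circle has mean zero. This identifies the leaf described by the generating
  function at \<open>c\<close> with the leaf of the same mean in the parametrisation of the foliation.\<close>

lemma circle_integral_leaf_function:
  assumes "generating_function \<F> u"
  shows "circle_integral (leaf_function u c) = c"
proof -
  let ?g = "\<lambda>x. u (abs_circle x, c)"
  have "?g C1_differentiable_on UNIV"
    using assms by (simp add: generating_function_def C1_circle_def)
  then have deriv: "(?g has_vector_derivative deriv ?g x) (at x)" for x
    by (metis C1_differentiable_on_def DERIV_imp_deriv UNIV_I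
        has_real_derivative_iff_has_vector_derivative)
  have "abs_circle 1 = abs_circle 0"
    by (simp add: circle.abs_eq_iff)
  then have "(deriv ?g has_integral 0) {0..1}"
    using fundamental_theorem_of_calculus[of 0 1 ?g "deriv ?g"] deriv
    by (auto intro: has_vector_derivative_at_within)
  then have "((\<lambda>x. c + deriv ?g x) has_integral c + 0) {0..1}"
    using has_integral_const_real[of c 0 1] by (intro has_integral_add) auto
  then show ?thesis
    by (simp add: circle_integral_def leaf_function_def circle_deriv.abs_eq integral_unique)
qed

lemma circle_graph_inj: "circle_graph g = circle_graph h \<Longrightarrow> g = h"
  by (auto simp: circle_graph_def fun_eq_iff set_eq_iff)

lemma leaf_function_eq:
  assumes u: "generating_function \<F> u" and \<F>: "\<F> = range (\<lambda>c. circle_graph (\<eta> c))"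
    and \<eta>: "\<And>c. circle_integral (\<eta> c) = c"
  shows "leaf_function u c = \<eta> c"
proof -
  have "circle_graph (leaf_function u c) \<in> \<F>"
    using u by (simp add: generating_function_def)
  then obtain c' where c': "leaf_function u c = \<eta> c'"
    using \<F> circle_graph_inj by auto
  then have "c = c'"
    using circle_integral_leaf_function[OF u, of c] \<eta>[of c'] by simp
  with c' show ?thesis by simp
qed

text \<open>A nonnegative Lipschitz function of height \<open>h\<close> at one point stays above \<open>h / 2\<close> on an interval of
  length \<open>h / (2 * L)\<close>, to one side at least of the point. The condition \<open>h \<le> L\<close> makes the interval fit.\<close>

lemma Lipschitz_square_le_integral:
  fixes D :: "real \<Rightarrow> real"
  assumes Lip: "\<And>x y. x \<in> {0..1} \<Longrightarrow> y \<in> {0..1} \<Longrightarrow> \<bar>D x - D y\<bar> \<le> L * \<bar>x - y\<bar>"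
    and cont: "continuous_on {0..1} D"
    and nonneg: "\<And>x. x \<in> {0..1} \<Longrightarrow> 0 \<le> D x"
    and x0: "x0 \<in> {0..1}" and L: "0 < L" "D x0 \<le> L"
  shows "(D x0)\<^sup>2 \<le> 4 * L * integral {0..1} D"
proof -
  define \<delta> where "\<delta> = D x0 / (2 * L)"
  have \<delta>: "0 \<le> \<delta>" "\<delta> \<le> 1/2"
    using L nonneg[OF x0] by (auto simp: \<delta>_def field_simps)
  define a where "a = (if x0 \<le> 1/2 then x0 else x0 - \<delta>)"
  have I: "{a..a + \<delta>} \<subseteq> {0..1}"
    using \<delta> x0 by (auto simp: a_def)
  have half: "D x0 / 2 \<le> D x" if x: "x \<in> {a..a + \<delta>}" for x
  proof -
    have "\<bar>x0 - x\<bar> \<le> \<delta>"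
      using x \<delta> by (auto simp: a_def split: if_splits)
    then have "L * \<bar>x0 - x\<bar> \<le> L * \<delta>"
      using L by (intro mult_left_mono) auto
    moreover have "L * \<delta> = D x0 / 2"
      using L by (simp add: \<delta>_def)
    ultimately show ?thesis
      using Lip[of x0 x] x I x0 by (auto simp: subset_iff)
  qed
  have "\<delta> * (D x0 / 2) = integral {a..a + \<delta>} (\<lambda>x. D x0 / 2)"
    using \<delta> by simp
  also have "\<dots> \<le> integral {a..a + \<delta>} D"
    using half by (intro integral_le integrable_continuous_interval continuous_on_subset[OF cont I]) auto
  also have "\<dots> \<le> integral {0..1} D"
    using nonneg by (intro integral_subset_le I integrable_continuous_interval continuous_on_subset[OF cont I] cont) auto
  finally show ?thesis
    using L by (simp add: \<delta>_def power2_eq_square field_simps)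
qed

text \<open>Applied to the difference of two disjoint leaves: it cannot change sign, so its sign is that of
  the enclosed area.\<close>

lemma nonvanishing_pos_if_integral_nonneg:
  fixes D :: "real \<Rightarrow> real"
  assumes cont: "continuous_on UNIV D" and nz: "\<And>x. D x \<noteq> 0" and int: "0 \<le> integral {0..1} D"
  shows "0 < D x"
proof (rule ccontr)
  assume "\<not> 0 < D x"
  have neg: "D y < 0" for y
  proof (rule ccontr)
    assume "\<not> D y < 0"
    have "connected (range D)"
      by (intro connected_continuous_image cont connected_UNIV)
    then have "0 \<in> range D"
      using \<open>\<not> 0 < D x\<close> \<open>\<not> D y < 0\<close> connectedD_interval[of "range D" "D x" "D y" 0] by simp
    then show False using nz by (metis imageE)
  qed
  have D: "continuous_on {0..1} D"
    using cont by (rule continuous_on_subset) simp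
  have "integral {0..1} D < integral {0..1::real} (\<lambda>y. 0)"
    by (rule integral_less_real[OF D]) (auto simp: neg)
  with int show False
    by simp
qed

theorem theorem1p2:
  fixes f :: "annulus \<Rightarrow> annulus" and \<F> :: "annulus set set" and u :: "annulus \<Rightarrow> real"
  assumes "symplectic_twist_diffeo f"
    and "invariant_foliation f \<F>"
    and "generating_function \<F> u"
  shows "\<forall>K :: annulus set. compact K \<longrightarrow>
           (\<exists>C. \<forall>\<theta> c c'. (\<theta>, c) \<in> K \<longrightarrow> (\<theta>, c') \<in> K \<longrightarrow>
              \<bar>leaf_function u c \<theta> - leaf_function u c' \<theta>\<bar> \<le> C * \<bar>c - c'\<bar> powr (1/2))"
proof (intro allI impI)
  fix K :: "annulus set"
  assume K: "compact K"
  obtain \<eta> where \<F>: "\<F> = range (\<lambda>c. circle_graph (\<eta> c))"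
    and cont: "\<And>c. continuous_on UNIV (\<eta> c)" and mean: "\<And>c. circle_integral (\<eta> c) = c"
    and homeo: "homeomorphic_map euclidean euclidean (\<lambda>(\<theta>, c). (\<theta>, \<eta> c \<theta>))"
    using assms(2) by (auto simp: invariant_foliation_def C0_foliation_def)
  have leaf: "leaf_function u c = \<eta> c" for c
    by (rule leaf_function_eq[OF assms(3) \<F> mean])
  have inv: "f ` circle_graph (\<eta> c) = circle_graph (\<eta> c)" for c
    using assms(2) \<F> by (auto simp: invariant_foliation_def)
  have joint: "continuous_on UNIV (\<lambda>p. (fst p, \<eta> (snd p) (fst p)))"
    using homeomorphic_imp_continuous_map[OF homeo] by (simp add: case_prod_beta)
  have inj: "inj (\<lambda>p. (fst p, \<eta> (snd p) (fst p)))"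
    using homeomorphic_imp_injective_map[OF homeo] unfolding case_prod_unfold by simp
  define e where "e c x = \<eta> c (abs_circle x)" for c x
  have e_cont: "continuous_on UNIV (e c)" for c
    unfolding e_def by (rule continuous_on_compose2[OF cont continuous_abs_circle]) auto
  have "compact (snd ` K)"
    using K by (intro compact_continuous_image continuous_intros)
  then obtain M where M: "\<And>p. p \<in> K \<Longrightarrow> \<bar>snd p\<bar> \<le> M"
    by (metis compact_imp_bounded bounded_iff imageI real_norm_def)
  have "continuous_on UNIV (\<lambda>p. (abs_circle (fst p), snd p))"
    by (intro continuous_intros continuous_on_compose2[OF continuous_abs_circle]) auto
  then have "continuous_on UNIV (\<lambda>p. e (snd p) (fst p))"
    using continuous_on_snd[OF continuous_on_compose2[OF joint]] by (fastforce simp: e_def)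
  then have "compact ((\<lambda>p. e (snd p) (fst p)) ` ({0..1} \<times> {-M..M}))"
    by (intro compact_continuous_image compact_Times compact_Icc) (rule continuous_on_subset, auto)
  then obtain R where R: "\<And>x c. x \<in> {0..1} \<Longrightarrow> \<bar>c\<bar> \<le> M \<Longrightarrow> \<bar>e c x\<bar> \<le> R"
    by (force dest!: compact_imp_bounded simp: bounded_iff)
  obtain L where L: "\<And>\<eta> x y. \<lbrakk>continuous_on UNIV \<eta>; f ` circle_graph \<eta> = circle_graph \<eta>;
      \<And>x. x \<in> {0..1} \<Longrightarrow> \<bar>\<eta> (abs_circle x)\<bar> \<le> R; x \<in> {0..1}; y \<in> {0..1}\<rbrakk>
      \<Longrightarrow> \<bar>\<eta> (abs_circle x) - \<eta> (abs_circle y)\<bar> \<le> L * \<bar>x - y\<bar>"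
    using invariant_graphs_uniformly_Lipschitz[OF assms(1)] by blast
  \<comment> \<open>The difference of two leaves is \<open>2 * L\<close>-Lipschitz and at most \<open>2 * R\<close>; the latter makes the interval of
    \<open>Lipschitz_square_le_integral\<close> fit.\<close>
  define N where "N = max (2 * L) (max (2 * R) 1)"
  have N: "N > 0" "2 * L \<le> N" "2 * R \<le> N"
    by (auto simp: N_def)
  have Lip: "\<bar>(e c x - e c' x) - (e c y - e c' y)\<bar> \<le> N * \<bar>x - y\<bar>"
    if "\<bar>c\<bar> \<le> M" "\<bar>c'\<bar> \<le> M" "x \<in> {0..1}" "y \<in> {0..1}" for c c' x y
  proof -
    have "\<bar>e c x - e c y\<bar> \<le> L * \<bar>x - y\<bar>" "\<bar>e c' x - e c' y\<bar> \<le> L * \<bar>x - y\<bar>"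
      using L[OF cont inv, of _ x y] R that unfolding e_def by blast+
    moreover have "2 * L * \<bar>x - y\<bar> \<le> N * \<bar>x - y\<bar>"
      using N by (intro mult_right_mono) auto
    ultimately show ?thesis by linarith
  qed
  have area: "integral {0..1} (\<lambda>x. e c' x - e c x) = c' - c" for c c'
    using mean[of c] mean[of c'] unfolding circle_integral_def e_def[symmetric]
    by (subst integral_diff)
      (auto intro!: integrable_continuous_interval continuous_on_subset[OF e_cont])
  have ordered: "e c x \<le> e c' x" if "c \<le> c'" for c c' x
  proof (cases "c = c'")
    case False
    have "e c' y - e c y \<noteq> 0" for y
      using injD[OF inj, of "(abs_circle y, c)" "(abs_circle y, c')"] False by (auto simp: e_def)
    then have "0 < e c' x - e c x"
      using area[of c' c] that
      by (intro nonvanishing_pos_if_integral_nonneg continuous_intros e_cont) auto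
    then show ?thesis by simp
  qed simp
  have square: "(e c' x - e c x)\<^sup>2 \<le> 4 * N * (c' - c)"
    if c: "\<bar>c\<bar> \<le> M" "\<bar>c'\<bar> \<le> M" "c \<le> c'" and x: "x \<in> {0..1}" for c c' x
  proof -
    have "(e c' x - e c x)\<^sup>2 \<le> 4 * N * integral {0..1} (\<lambda>y. e c' y - e c y)"
    proof (rule Lipschitz_square_le_integral[OF _ _ _ x N(1)])
      show "e c' x - e c x \<le> N"
        using R[OF x c(1)] R[OF x c(2)] N(3) by linarith
    qed (use Lip c ordered in \<open>auto intro!: continuous_intros continuous_on_subset[OF e_cont]\<close>)
    then show ?thesis by (simp add: area)
  qed
  have root: "\<bar>e c x - e c' x\<bar> \<le> sqrt (4 * N) * \<bar>c - c'\<bar> powr (1/2)"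
    if "\<bar>c\<bar> \<le> M" "\<bar>c'\<bar> \<le> M" "x \<in> {0..1}" for c c' x
  proof -
    have "(e c x - e c' x)\<^sup>2 \<le> 4 * N * \<bar>c - c'\<bar>"
      using square[of c c' x] square[of c' c x] that
      by (cases "c \<le> c'") (auto simp: power2_commute)
    then have "\<bar>e c x - e c' x\<bar> \<le> sqrt (4 * N * \<bar>c - c'\<bar>)"
      by (metis real_sqrt_abs real_sqrt_le_mono)
    then show ?thesis
      by (simp add: real_sqrt_mult powr_half_sqrt)
  qed
  have fundamental_domain: "\<exists>x\<in>{0..1}. \<theta> = abs_circle x" for \<theta>
  proof -
    obtain t where t: "\<theta> = abs_circle t"
      by (metis Quotient3_abs_rep Quotient3_circle)
    have "abs_circle t = abs_circle (frac t)"
      by (simp add: circle.abs_eq_iff frac_def)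
    moreover have "frac t \<in> {0..1}"
      using frac_lt_1[of t] by simp
    ultimately show ?thesis using t by blast
  qed
  show "\<exists>C. \<forall>\<theta> c c'. (\<theta>, c) \<in> K \<longrightarrow> (\<theta>, c') \<in> K \<longrightarrow>
      \<bar>leaf_function u c \<theta> - leaf_function u c' \<theta>\<bar> \<le> C * \<bar>c - c'\<bar> powr (1/2)"
    using root M fundamental_domain unfolding leaf e_def by (metis snd_conv)
qed

end
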